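(* For every positive integer $k$ there exist a planar graph $G$ and a $( *,1)$-list assignment $L$ of $G$ such that $|L(v)|\geq 2$ for every $v\in V(G)$, $|L(u)\cup L(v)|\geq k$ for every edge $uv\in E(G)$, and $G$ is not $L$-colorable.
   Context: Graphs are finite and simple. A list assignment $L$ of a graph $G$ assigns to each vertex $v\in V(G)$ a list (set) of colors $L(v)$. An $L$-coloring of $G$ is a mapping $\varphi$ on $V(G)$ such that $\varphi(v)\in L(v)$ for each vertex $v$ and $\varphi(x)\neq\varphi(y)$ for each edge $xy$ of $G$; $G$ is $L$-colorable if it has an $L$-coloring. A $( *,1)$-list assignment of $G$ is a list assignment $L$ such that $|L(v)|\geq 1$ for every vertex $v$ and $|L(u)\cap L(v)|\leq 1$ for every pair of adjacent vertices $u,v$. *)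

theory Defs
  imports "HOL-Analysis.Analysis"
begin

definition simple_graph :: "'a set \<Rightarrow> 'a set set \<Rightarrow> bool" where
  "simple_graph V E \<longleftrightarrow>
     finite V \<and> (\<forall>e\<in>E. \<exists>u v. u \<in> V \<and> v \<in> V \<and> u \<noteq> v \<and> e = {u, v})"

text \<open>
  A drawing in the Euclidean plane without crossings. The constant \<open>arc\<close> means an injective
  continuous path on the unit interval; an edge has no direction, so only the set of the two
  endpoints of its curve is prescribed. Since curves contain their endpoints, the last two
  clauses say that a curve passes through no vertex other than its ends, and that two distinct
  curves meet at most in the position of a common end.
\<close>

definition plane_drawing ::
  "'a set \<Rightarrow> 'a set set \<Rightarrow> ('a \<Rightarrow> real \<times> real) \<Rightarrow> ('a set \<Rightarrow> real \<Rightarrow> real \<times> real) \<Rightarrow> bool" where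
  "plane_drawing V E p \<gamma> \<longleftrightarrow>
     inj_on p V \<and>
     (\<forall>e\<in>E. arc (\<gamma> e) \<and> {pathstart (\<gamma> e), pathfinish (\<gamma> e)} = p ` e) \<and>
     (\<forall>e\<in>E. path_image (\<gamma> e) \<inter> p ` V \<subseteq> p ` e) \<and>
     (\<forall>e\<in>E. \<forall>f\<in>E. e \<noteq> f \<longrightarrow> path_image (\<gamma> e) \<inter> path_image (\<gamma> f) \<subseteq> p ` (e \<inter> f))"

definition planar :: "'a set \<Rightarrow> 'a set set \<Rightarrow> bool" where
  "planar V E \<longleftrightarrow> (\<exists>p \<gamma>. plane_drawing V E p \<gamma>)"

text \<open>
  Lists are finite sets; in particular \<open>card\<close> below is the true cardinality of the lists and of
  their unions and intersections.
\<close>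

definition list_assignment :: "'a set \<Rightarrow> ('a \<Rightarrow> 'c set) \<Rightarrow> bool" where
  "list_assignment V L \<longleftrightarrow> (\<forall>v\<in>V. finite (L v))"

definition list_coloring ::
  "'a set \<Rightarrow> 'a set set \<Rightarrow> ('a \<Rightarrow> 'c set) \<Rightarrow> ('a \<Rightarrow> 'c) \<Rightarrow> bool" where
  "list_coloring V E L \<phi> \<longleftrightarrow>
     (\<forall>v\<in>V. \<phi> v \<in> L v) \<and> (\<forall>x y. {x, y} \<in> E \<longrightarrow> \<phi> x \<noteq> \<phi> y)"

definition list_colorable :: "'a set \<Rightarrow> 'a set set \<Rightarrow> ('a \<Rightarrow> 'c set) \<Rightarrow> bool" where
  "list_colorable V E L \<longleftrightarrow> (\<exists>\<phi>. list_coloring V E L \<phi>)"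

definition star_one_list_assignment :: "'a set \<Rightarrow> 'a set set \<Rightarrow> ('a \<Rightarrow> 'c set) \<Rightarrow> bool" where
  "star_one_list_assignment V E L \<longleftrightarrow>
     list_assignment V L \<and>
     (\<forall>v\<in>V. card (L v) \<ge> 1) \<and>
     (\<forall>u v. {u, v} \<in> E \<longrightarrow> card (L u \<inter> L v) \<le> 1)"

end

theory Submission
  imports Defs
begin

text \<open>
  Two vertices, called poles, receive disjoint lists \<open>A\<close> and \<open>B\<close> of size \<open>n\<close>. For every pair
  \<open>(a, b)\<close> in \<open>A \<times> B\<close> a further vertex with list \<open>{a, b}\<close> is joined to both poles. Whatever
  colors \<open>a\<close> and \<open>b\<close> the poles receive, the vertex with list \<open>{a, b}\<close> has no color left, so there
  is no coloring. Each edge joins a list of size \<open>2\<close> to a list of size \<open>n\<close> that shares exactly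
  one color with it, so the union of the two lists has \<open>n + 1\<close> elements, which is as large as
  desired.

  The graph is the complete bipartite graph \<open>K\<^sub>2\<^sub>,\<^sub>m\<close> with \<open>m = n\<^sup>2\<close>. It is planar: put one pole
  above the horizontal axis, the other one below it, the remaining vertices on the axis, and draw
  the edges as straight segments (\<open>planar_K2\<close>). Segments from the same pole have different
  directions, and segments from different poles lie in opposite closed half-planes, so that they
  can only meet on the axis.
\<close>

text \<open>The terms \<open>i + 2\<close> that name the vertices on the axis have to survive simplification.\<close>

declare add_2_eq_Suc' [simp del]

definition K2_vertices :: "nat \<Rightarrow> nat set" where
  "K2_vertices m = {..<m + 2}"

definition K2_edges :: "nat \<Rightarrow> nat set set" where
  "K2_edges m = {{c, i + 2} | c i. c < 2 \<and> i < m}"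

definition K2_position :: "nat \<Rightarrow> real \<times> real" where
  "K2_position v =
     (if v = 0 then (0, 1) else if v = 1 then (0, -1) else (real (v - 2), 0))"

text \<open>
  The pole of an edge is its smaller end, so \<open>Min\<close> and \<open>Max\<close> recover an orientation from the set.
\<close>

definition K2_curve :: "nat set \<Rightarrow> real \<Rightarrow> real \<times> real" where
  "K2_curve e = linepath (K2_position (Min e)) (K2_position (Max e))"

lemma K2_vertex_cases:
  assumes "v \<in> K2_vertices m"
  obtains (pole) "v < 2" | (axis) i where "i < m" "v = i + 2"
proof (cases "v < 2")
  case False
  then show ?thesis
    using assms axis[of "v - 2"] by (auto simp: K2_vertices_def)
qed (rule pole)

lemma simple_graph_K2: "simple_graph (K2_vertices m) (K2_edges m)"
proof -
  have "\<exists>u v. u \<in> K2_vertices m \<and> v \<in> K2_vertices m \<and> u \<noteq> v \<and> e = {u, v}"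
    if e: "e \<in> K2_edges m" for e
  proof -
    obtain c i where ci: "c < 2" "i < m" "e = {c, i + 2}"
      using e unfolding K2_edges_def by blast
    then have "c \<in> K2_vertices m" "i + 2 \<in> K2_vertices m" "c \<noteq> i + 2"
      by (auto simp: K2_vertices_def)
    then show ?thesis using ci(3) by blast
  qed
  then show ?thesis
    by (simp add: simple_graph_def K2_vertices_def)
qed

lemma K2_position_axis [simp]: "K2_position (i + 2) = (real i, 0)"
  by (simp add: K2_position_def)

lemma K2_position_pole: "c < 2 \<Longrightarrow> K2_position c = (0, 1 - 2 * real c)"
  by (auto simp: K2_position_def less_2_cases_iff)

lemma inj_K2_position: "inj K2_position"
proof (rule injI)
  fix v w assume "K2_position v = K2_position w"
  then show "v = w"
    by (auto simp: K2_position_def split: if_splits)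
qed

lemma K2_curve_edge:
  "c < 2 \<Longrightarrow> K2_curve {c, i + 2} = linepath (K2_position c) (K2_position (i + 2))"
  by (simp add: K2_curve_def min_def max_def)

lemma path_image_K2_curve:
  assumes "c < 2" and "z \<in> path_image (K2_curve {c, i + 2})"
  obtains t where "0 \<le> t" "t \<le> 1" "z = (t * real i, (1 - t) * (1 - 2 * real c))"
proof -
  have "z \<in> closed_segment (0, 1 - 2 * real c) (real i, 0)"
    using assms by (simp add: K2_curve_edge K2_position_pole)
  then show ?thesis
    using that by (auto simp: closed_segment_def)
qed

lemma K2_curve_avoids_vertices:
  assumes c: "c < 2" and z: "z \<in> path_image (K2_curve {c, i + 2})" "z = K2_position v"
    and v: "v \<in> K2_vertices m"
  shows "v \<in> {c, i + 2}"
proof -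
  obtain t where t: "0 \<le> t" "t \<le> 1" "z = (t * real i, (1 - t) * (1 - 2 * real c))"
    using path_image_K2_curve c z(1) by blast
  from v show ?thesis
  proof (cases rule: K2_vertex_cases)
    case pole
    then show ?thesis
      using t z(2) c by (auto simp: K2_position_pole less_2_cases_iff)
  next
    case (axis j)
    then show ?thesis
      using t z(2) c by (auto simp: less_2_cases_iff)
  qed
qed

text \<open>
  The height of a point of a segment determines both its pole, unless the height is \<open>0\<close>, and the
  parameter \<open>t\<close>; the abscissa \<open>t * real i\<close> then determines \<open>i\<close>, unless \<open>t = 0\<close>.
\<close>

lemma K2_curves_meet:
  assumes c: "c < 2" and d: "d < 2" and ne: "{c, i + 2} \<noteq> {d, j + 2}"
    and zc: "z \<in> path_image (K2_curve {c, i + 2})"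
    and zd: "z \<in> path_image (K2_curve {d, j + 2})"
  shows "z \<in> K2_position ` ({c, i + 2} \<inter> {d, j + 2})"
proof -
  obtain t where t: "0 \<le> t" "t \<le> 1" "z = (t * real i, (1 - t) * (1 - 2 * real c))"
    using path_image_K2_curve c zc by blast
  obtain s where s: "0 \<le> s" "s \<le> 1" "z = (s * real j, (1 - s) * (1 - 2 * real d))"
    using path_image_K2_curve d zd by blast
  show ?thesis
  proof (cases "c = d")
    case True
    then have "i \<noteq> j" using ne by auto
    moreover have "t = s" using t s True c by (auto simp: less_2_cases_iff)
    \<comment> \<open>At equal heights the two abscissae agree only at the pole.\<close>
    ultimately have "t = 0" using t(3) s(3) by auto
    then have "z = K2_position c" using t(3) c by (simp add: K2_position_pole)
    then show ?thesis using True by blast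
  next
    case False
    then have "1 - t = - (1 - s)" using t s c d by (auto simp: less_2_cases_iff)
    then have "t = 1" "s = 1" using t s by linarith+
    then have "i = j" "z = K2_position (i + 2)" using t(3) s(3) by auto
    then show ?thesis by blast
  qed
qed

lemma planar_K2: "planar (K2_vertices m) (K2_edges m)"
proof -
  have "arc (K2_curve e) \<and>
        {pathstart (K2_curve e), pathfinish (K2_curve e)} = K2_position ` e"
    if "e \<in> K2_edges m" for e
  proof -
    from that obtain c i where e: "c < 2" "e = {c, i + 2}"
      by (auto simp: K2_edges_def)
    then have "K2_position c \<noteq> K2_position (i + 2)"
      unfolding inj_eq[OF inj_K2_position] by simp
    then show ?thesis
      using e by (simp add: K2_curve_edge)
  qed
  moreover have "path_image (K2_curve e) \<inter> K2_position ` K2_vertices m \<subseteq> K2_position ` e"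
    if "e \<in> K2_edges m" for e
    using that K2_curve_avoids_vertices unfolding K2_edges_def by blast
  moreover have "path_image (K2_curve e) \<inter> path_image (K2_curve f) \<subseteq> K2_position ` (e \<inter> f)"
    if "e \<in> K2_edges m" "f \<in> K2_edges m" "e \<noteq> f" for e f
    using that K2_curves_meet unfolding K2_edges_def by blast
  moreover have "inj_on K2_position (K2_vertices m)"
    using inj_on_subset[OF inj_K2_position] by simp
  ultimately have "plane_drawing (K2_vertices m) (K2_edges m) K2_position K2_curve"
    by (simp add: plane_drawing_def)
  then show ?thesis
    unfolding planar_def by blast
qed

text \<open>
  Writing \<open>i < n\<^sup>2\<close> in base \<open>n\<close> enumerates the pairs of a color of the one pole and a color of
  the other: the first digit is a color of pole \<open>0\<close>, and the second one, shifted by \<open>n\<close>, a color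
  of pole \<open>1\<close>.
\<close>

definition pair_lists :: "nat \<Rightarrow> nat \<Rightarrow> nat set" where
  "pair_lists n v =
     (if v < 2 then {v * n..<v * n + n} else {(v - 2) div n, n + (v - 2) mod n})"

lemma pair_lists_pole: "c < 2 \<Longrightarrow> pair_lists n c = {c * n..<c * n + n}"
  by (simp add: pair_lists_def)

lemma pair_lists_axis: "pair_lists n (i + 2) = {i div n, n + i mod n}"
  by (simp add: pair_lists_def)

lemma div_less_of_less_square: "i < n * n \<Longrightarrow> i div n < (n :: nat)"
  by (simp add: less_mult_imp_div_less)

lemma card_pair_lists_axis:
  assumes "i < n * n"
  shows "card (pair_lists n (i + 2)) = 2"
  using div_less_of_less_square[OF assms] by (simp add: pair_lists_axis)

lemma card_pair_lists:
  assumes "2 \<le> n" "v \<in> K2_vertices (n * n)"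
  shows "2 \<le> card (pair_lists n v)"
  using assms(2)
proof (cases rule: K2_vertex_cases)
  case pole
  then show ?thesis using assms(1) by (simp add: pair_lists_pole)
next
  case (axis i)
  then show ?thesis using card_pair_lists_axis by simp
qed

lemma card_pair_lists_Int:
  assumes "c < 2" "i < n * n"
  shows "card (pair_lists n c \<inter> pair_lists n (i + 2)) = 1"
proof -
  have "i div n < n" "i mod n < n"
    using assms(2) div_less_of_less_square by (auto intro!: mod_less_divisor gr0I)
  then have "pair_lists n c \<inter> pair_lists n (i + 2) =
      {if c = 0 then i div n else n + i mod n}"
    using assms(1) by (auto simp: pair_lists_pole pair_lists_axis less_2_cases_iff)
  then show ?thesis by simp
qed

lemma card_pair_lists_Un:
  assumes "c < 2" "i < n * n"
  shows "card (pair_lists n c \<union> pair_lists n (i + 2)) = n + 1"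
proof -
  have "finite (pair_lists n v)" for v
    by (simp add: pair_lists_def)
  then have "card (pair_lists n c) + card (pair_lists n (i + 2)) =
      card (pair_lists n c \<union> pair_lists n (i + 2)) +
      card (pair_lists n c \<inter> pair_lists n (i + 2))"
    by (intro card_Un_Int)
  moreover have "card (pair_lists n c) = n"
    using assms(1) by (simp add: pair_lists_pole)
  ultimately show ?thesis
    using card_pair_lists_Int[OF assms] card_pair_lists_axis[OF assms(2)] by simp
qed

lemma not_list_colorable_K2:
  "\<not> list_colorable (K2_vertices (n * n)) (K2_edges (n * n)) (pair_lists n)"
proof
  assume "list_colorable (K2_vertices (n * n)) (K2_edges (n * n)) (pair_lists n)"
  then obtain \<phi> where
    \<phi>: "\<And>v. v \<in> K2_vertices (n * n) \<Longrightarrow> \<phi> v \<in> pair_lists n v" and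
    proper: "\<And>x y. {x, y} \<in> K2_edges (n * n) \<Longrightarrow> \<phi> x \<noteq> \<phi> y"
    unfolding list_colorable_def list_coloring_def by blast
  have a: "\<phi> 0 < n" and b: "n \<le> \<phi> 1" "\<phi> 1 < 2 * n"
    using \<phi>[of 0] \<phi>[of 1] by (auto simp: K2_vertices_def pair_lists_def)
  then obtain d where d: "\<phi> 1 = n + d" "d < n"
    by (auto simp: le_iff_add)
  \<comment> \<open>The vertex whose list consists of the two colors used on the poles.\<close>
  define i where "i = d + \<phi> 0 * n"
  have digits: "i div n = \<phi> 0" "n + i mod n = \<phi> 1"
    using a d by (simp_all add: i_def)
  have "i < \<phi> 0 * n + n"
    using d by (simp add: i_def)
  also have "\<dots> = Suc (\<phi> 0) * n"
    by simp
  also have "\<dots> \<le> n * n"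
    using a by (intro mult_right_mono) auto
  finally have i: "i < n * n" .
  then have "\<phi> (i + 2) \<in> {\<phi> 0, \<phi> 1}"
    using \<phi>[of "i + 2"] digits
    by (simp add: K2_vertices_def pair_lists_axis)
  moreover have "{0, i + 2} \<in> K2_edges (n * n)" "{1, i + 2} \<in> K2_edges (n * n)"
    using i unfolding K2_edges_def by force+
  ultimately show False
    using proper by fastforce
qed

theorem theorem4:
  fixes k :: nat
  assumes "k \<ge> 1"
  shows "\<exists>(V :: nat set) (E :: nat set set) (L :: nat \<Rightarrow> nat set).
           simple_graph V E \<and> planar V E \<and>
           star_one_list_assignment V E L \<and>
           (\<forall>v\<in>V. card (L v) \<ge> 2) \<and>
           (\<forall>u v. {u, v} \<in> E \<longrightarrow> card (L u \<union> L v) \<ge> k) \<and>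
           \<not> list_colorable V E L"
proof -
  \<comment> \<open>Large enough for \<open>n + 1 \<ge> k\<close>, and for \<open>n \<ge> 2\<close>, which the lists of the poles need.\<close>
  define n where "n = k + 1"
  let ?V = "K2_vertices (n * n)" and ?E = "K2_edges (n * n)" and ?L = "pair_lists n"
  have n: "2 \<le> n" "k \<le> n + 1"
    using assms by (auto simp: n_def)
  have edge: "card (?L u \<inter> ?L v) = 1 \<and> card (?L u \<union> ?L v) = n + 1"
    if uv: "{u, v} \<in> ?E" for u v
  proof -
    from uv obtain c i where ci: "{u, v} = {c, i + 2}" "c < 2" "i < n * n"
      unfolding K2_edges_def by blast
    then have "u = c \<and> v = i + 2 \<or> u = i + 2 \<and> v = c"
      by (simp add: doubleton_eq_iff)
    then show ?thesis
      using card_pair_lists_Int[OF ci(2,3)] card_pair_lists_Un[OF ci(2,3)]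
      by (auto simp: Int_commute Un_commute)
  qed
  have lists: "\<forall>v\<in>?V. 2 \<le> card (?L v)"
    using card_pair_lists[OF n(1)] by blast
  have "finite (?L v)" for v
    by (simp add: pair_lists_def)
  then have "star_one_list_assignment ?V ?E ?L"
    unfolding star_one_list_assignment_def list_assignment_def
    using edge lists by fastforce
  then show ?thesis
    using simple_graph_K2 planar_K2 lists edge n(2) not_list_colorable_K2 by metis
qed

end
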